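(* Let $k\ge 2$ and let $n_1,\ldots,n_k\ge 3$ be integers. Let $H_k = P_{n_1}\boxtimes \cdots \boxtimes P_{n_k}$. Then $$\mu(H_k) = \prod_{i=1}^k n_i - \prod_{i=1}^k (n_i - 2).$$
   Context: $P_n$ denotes the path on $n$ vertices. For a connected graph $G$ and $X\subseteq V(G)$, two vertices $x,y\in V(G)$ are $X$-visible if there is a shortest $x,y$-path in $G$ none of whose internal vertices lies in $X$. A set $X\subseteq V(G)$ is a mutual-visibility set if its vertices are pairwise $X$-visible, and the mutual-visibility number $\mu(G)$ is the largest cardinality of a mutual-visibility set of $G$. The strong product $G\boxtimes H$ has vertex set $V(G)\times V(H)$, and two distinct vertices $(g,h)$ and $(g',h')$ are adjacent iff ($g=g'$ or $gg'\in E(G)$) and ($h=h'$ or $hh'\in E(H)$); it is associative, so the product of several factors is well defined. *)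

theory Defs
  imports "Graph_Theory.Graph_Theory"
begin

text \<open>
  A simple graph is a symmetric loop-free \<open>pair_pre_digraph\<close> (\<open>pair_graph\<close>), i.e. an edge
  $uv$ is represented by the two arcs $(u,v)$ and $(v,u)$. Paths are the library's
  \<open>vpath\<close>s: non-empty lists of distinct vertices, consecutive ones adjacent.
\<close>

definition path_graph :: "nat \<Rightarrow> nat pair_pre_digraph" where
  "path_graph n = \<lparr> pverts = {..<n},
     parcs = {(i, j). i < n \<and> j < n \<and> (j = Suc i \<or> i = Suc j)} \<rparr>"

definition strong_product ::
  "'a pair_pre_digraph \<Rightarrow> 'b pair_pre_digraph \<Rightarrow> ('a \<times> 'b) pair_pre_digraph"
  (infixr \<open>\<boxtimes>\<close> 70) where
  "G \<boxtimes> H = \<lparr> pverts = pverts G \<times> pverts H,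
     parcs = {((g, h), (g', h')).
       (g, h) \<in> pverts G \<times> pverts H \<and> (g', h') \<in> pverts G \<times> pverts H \<and>
       (g, h) \<noteq> (g', h') \<and>
       (g = g' \<or> (g, g') \<in> parcs G) \<and> (h = h' \<or> (h, h') \<in> parcs H)} \<rparr>"

definition rename_verts :: "('a \<Rightarrow> 'b) \<Rightarrow> 'a pair_pre_digraph \<Rightarrow> 'b pair_pre_digraph" where
  "rename_verts f G = \<lparr> pverts = f ` pverts G, parcs = map_prod f f ` parcs G \<rparr>"

text \<open>
  The iterated product $G_1 \boxtimes (G_2 \boxtimes (\cdots \boxtimes G_k))$, where the nested
  tuple $(x_1,(x_2,\ldots))$ is renamed to the list $[x_1,\ldots,x_k]$ so that all numbers of
  factors share one type. The empty product is the one-vertex graph, neutral for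
  \<open>\<boxtimes>\<close> up to isomorphism.
\<close>

primrec strong_products :: "'a pair_pre_digraph list \<Rightarrow> 'a list pair_pre_digraph" where
  "strong_products [] = \<lparr> pverts = {[]}, parcs = {} \<rparr>"
| "strong_products (G # Gs) = rename_verts (\<lambda>(x, xs). x # xs) (G \<boxtimes> strong_products Gs)"

definition shortest_path :: "'a pair_pre_digraph \<Rightarrow> 'a \<Rightarrow> 'a list \<Rightarrow> 'a \<Rightarrow> bool" where
  "shortest_path G x p y \<longleftrightarrow>
     vpath p G \<and> hd p = x \<and> last p = y \<and>
     (\<forall>q. vpath q G \<and> hd q = x \<and> last q = y \<longrightarrow> vwalk_length p \<le> vwalk_length q)"

definition visible :: "'a pair_pre_digraph \<Rightarrow> 'a set \<Rightarrow> 'a \<Rightarrow> 'a \<Rightarrow> bool" where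
  "visible G X x y \<longleftrightarrow> (\<exists>p. shortest_path G x p y \<and> (set p - {x, y}) \<inter> X = {})"

text \<open>
  The case \<open>x = y\<close> below is harmless: the one-vertex path has no internal vertices.
\<close>

definition mutual_visibility_set :: "'a pair_pre_digraph \<Rightarrow> 'a set \<Rightarrow> bool" where
  "mutual_visibility_set G X \<longleftrightarrow> X \<subseteq> pverts G \<and> (\<forall>x\<in>X. \<forall>y\<in>X. visible G X x y)"

text \<open>For finite \<open>G\<close>; the maximum is over a non-empty set since \<open>{}\<close> qualifies.\<close>

definition mutual_visibility_number :: "'a pair_pre_digraph \<Rightarrow> nat" where
  "mutual_visibility_number G = Max {card X | X. mutual_visibility_set G X}"

lemma pair_graph_path_graph: "pair_graph (path_graph n)"
proof
  have "parcs (path_graph n) \<subseteq> {..<n} \<times> {..<n}" by (auto simp: path_graph_def)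
  then show "finite (parcs (path_graph n))" by (rule finite_subset) simp
qed (auto simp: path_graph_def symmetric_def sym_def)

lemma pair_graph_strong_product:
  assumes "pair_graph G" "pair_graph H"
  shows "pair_graph (G \<boxtimes> H)"
proof -
  interpret G: pair_graph G by fact
  interpret H: pair_graph H by fact
  have s: "(a, b) \<in> parcs G \<Longrightarrow> (b, a) \<in> parcs G" "(c, d) \<in> parcs H \<Longrightarrow> (d, c) \<in> parcs H"
    for a b c d
    using G.pair_sym_arcs H.pair_sym_arcs by (auto simp: symmetric_def sym_def)
  show ?thesis
  proof
    show fin: "finite (pverts (G \<boxtimes> H))"
      by (simp add: strong_product_def G.pair_finite_verts H.pair_finite_verts)
    have "parcs (G \<boxtimes> H) \<subseteq> pverts (G \<boxtimes> H) \<times> pverts (G \<boxtimes> H)"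
      by (auto simp: strong_product_def)
    then show "finite (parcs (G \<boxtimes> H))" by (rule finite_subset) (simp add: fin)
  qed (auto simp: strong_product_def symmetric_def sym_def dest: s)
qed

lemma strong_product_assoc:
  "rename_verts (\<lambda>((x, y), z). (x, (y, z))) ((G \<boxtimes> H) \<boxtimes> K) = G \<boxtimes> (H \<boxtimes> K)"
  by (force simp: rename_verts_def strong_product_def image_iff)

lemma pverts_strong_products:
  "pverts (strong_products Gs) = {xs. list_all2 (\<lambda>x G. x \<in> pverts G) xs Gs}"
  by (induction Gs) (auto simp: rename_verts_def strong_product_def list_all2_Cons2 image_iff)

lemma parcs_strong_products:
  "(xs, ys) \<in> parcs (strong_products Gs) \<longleftrightarrow>
     xs \<in> pverts (strong_products Gs) \<and> ys \<in> pverts (strong_products Gs) \<and> xs \<noteq> ys \<and>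
     (\<forall>i < length Gs. xs ! i = ys ! i \<or> (xs ! i, ys ! i) \<in> parcs (Gs ! i))"
proof (induction Gs arbitrary: xs ys)
  case Nil
  then show ?case by simp
next
  case (Cons G Gs)
  show ?case
    by (cases xs; cases ys)
      (auto simp: rename_verts_def strong_product_def image_iff All_less_Suc2 Cons.IH)
qed

end

theory Submission
  imports Defs
begin

text \<open>
  The strong product of paths is a box of lattice points with the Chebyshev metric. Clamping
  a geodesic of the box away from the boundary leaves its steps of length at most one, so any
  two vertices are joined by a shortest path with internal vertices in the interior; hence
  the boundary is a mutual-visibility set. Conversely, two vertices on a line of direction
  $(1,\ldots,1)$ are joined by a unique shortest path, so a mutual-visibility set meets each such
  line in at most two points, and the boundary consists exactly of the end points of these lines.
\<close>

section \<open>Vertices, arcs and walks of the grid in coordinates\<close>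

text \<open>The indexed form suits walks given as functions of time: bounds and adjacency are then
  checked one step at a time.\<close>

lemma vwalk_iff_nth:
  "vwalk p (with_proj G) \<longleftrightarrow>
     p \<noteq> [] \<and> set p \<subseteq> pverts G \<and> (\<forall>j. Suc j < length p \<longrightarrow> (p ! j, p ! Suc j) \<in> parcs G)"
proof -
  have "set (vwalk_arcs p) = {(p ! j, p ! Suc j) | j. Suc j < length p}"
  proof (induction p rule: vwalk_arcs.induct)
    case (3 x y xs)
    \<comment> \<open>Splits off the first arc, matching the recursion of
      \<open>vwalk_arcs\<close>.\<close>
    have "{(f j, g j) | j. Suc j < Suc (Suc m)} =
        insert (f 0, g 0) {(f (Suc j), g (Suc j)) | j. Suc j < Suc m}"
      for f g :: "nat \<Rightarrow> 'a" and m
      by (auto simp: less_Suc_eq_0_disj)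
    from this[where f = "\<lambda>j. (x # y # xs) ! j" and g = "\<lambda>j. (x # y # xs) ! Suc j"
        and m = "length xs"] 3
    show ?case by simp
  qed auto
  then show ?thesis
    by (auto simp: vwalk_def arcs_ends_def arc_to_ends_def)
qed

abbreviation grid :: "nat list \<Rightarrow> nat list pair_pre_digraph" where
  "grid ns \<equiv> strong_products (map path_graph ns)"

text \<open>\<open>box\<close> and \<open>core\<close> are both coordinatewise
  \<open>list_all2\<close> conditions, so that one product formula counts them.\<close>

definition box :: "nat list \<Rightarrow> nat list set" where
  "box ns = {xs. list_all2 (<) xs ns}"

definition core :: "nat list \<Rightarrow> nat list set" where
  "core ns = {xs. list_all2 (\<lambda>x n. 0 < x \<and> Suc x < n) xs ns}"

lemma mem_box: "xs \<in> box ns \<longleftrightarrow> length xs = length ns \<and> (\<forall>i<length ns. xs ! i < ns ! i)"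
  by (auto simp: box_def list_all2_conv_all_nth)

lemma mem_core:
  "xs \<in> core ns \<longleftrightarrow> length xs = length ns \<and> (\<forall>i<length ns. 0 < xs ! i \<and> Suc (xs ! i) < ns ! i)"
  by (auto simp: core_def list_all2_conv_all_nth)

lemma core_subset_box: "core ns \<subseteq> box ns"
  by (simp add: mem_core mem_box subset_iff Suc_lessD)

lemma pverts_grid: "pverts (grid ns) = box ns"
  by (simp add: pverts_strong_products box_def list_all2_map2 path_graph_def)

text \<open>Equal or adjacent in a path means difference at most one, so the arcs are the king moves
  of the box. Differences are taken in \<open>int\<close> to avoid truncation.\<close>

lemma parcs_grid:
  "(xs, ys) \<in> parcs (grid ns) \<longleftrightarrow> xs \<in> box ns \<and> ys \<in> box ns \<and> xs \<noteq> ys \<and>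
     (\<forall>i<length ns. \<bar>int (xs ! i) - int (ys ! i)\<bar> \<le> 1)"
proof -
  have coord: "(a = b \<or> (a, b) \<in> parcs (path_graph m)) \<longleftrightarrow> \<bar>int a - int b\<bar> \<le> 1"
    if "a < m" "b < m" for a b m
    using that by (auto simp: path_graph_def)
  have "(\<forall>i<length ns. xs ! i = ys ! i \<or> (xs ! i, ys ! i) \<in> parcs (map path_graph ns ! i))
      \<longleftrightarrow> (\<forall>i<length ns. \<bar>int (xs ! i) - int (ys ! i)\<bar> \<le> 1)"
    if "xs \<in> box ns" "ys \<in> box ns"
    using that coord by (simp add: mem_box)
  then show ?thesis
    unfolding parcs_strong_products pverts_grid by auto
qed

section \<open>Counting the box and its interior\<close>

lemma finite_list_all2:
  assumes "\<And>n. finite {x. P x n}"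
  shows "finite {xs. list_all2 P xs ns}"
proof (induction ns)
  case (Cons n ns)
  have "{xs. list_all2 P xs (n # ns)} = (\<lambda>(x, xs). x # xs) ` ({x. P x n} \<times> {xs. list_all2 P xs ns})"
    by (auto simp: list_all2_Cons2)
  then show ?case using assms Cons by simp
qed simp

lemma card_list_all2: "card {xs. list_all2 P xs ns} = (\<Prod>n\<leftarrow>ns. card {x. P x n})"
proof (induction ns)
  case (Cons n ns)
  have "{xs. list_all2 P xs (n # ns)} = (\<lambda>(x, xs). x # xs) ` ({x. P x n} \<times> {xs. list_all2 P xs ns})"
    by (auto simp: list_all2_Cons2)
  moreover have "inj_on (\<lambda>(x, xs). x # xs) A" for A :: "('a \<times> 'a list) set"
    by (auto simp: inj_on_def)
  ultimately show ?case using Cons by (simp add: card_image card_cartesian_product)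
qed simp

lemma finite_box: "finite (box ns)"
  unfolding box_def by (rule finite_list_all2) simp

lemma card_box: "card (box ns) = prod_list ns"
  by (simp add: box_def card_list_all2)

lemma card_core: "card (core ns) = (\<Prod>n\<leftarrow>ns. n - 2)"
proof -
  \<comment> \<open>For \<open>n < 2\<close> the interval is empty and the truncated
    \<open>n - 2\<close> is 0, so the count holds for every \<open>n\<close>.\<close>
  have "{x. 0 < x \<and> Suc x < n} = {1..<n - 1}" for n by auto
  then have "card {x. 0 < x \<and> Suc x < n} = n - 2" for n by simp
  then show ?thesis by (simp add: core_def card_list_all2)
qed

section \<open>Walks are at least as long as the Chebyshev distance\<close>

lemma grid_vwalk_nth_diff:
  assumes "vwalk p (grid ns)" "i < length ns" "j \<le> j'" "j' < length p"
  shows "\<bar>int (p ! j' ! i) - int (p ! j ! i)\<bar> \<le> int j' - int j"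
  using assms(3,4)
proof (induction j' rule: dec_induct)
  case (step m)
  then have "(p ! m, p ! Suc m) \<in> parcs (grid ns)"
    using assms(1) by (simp add: vwalk_iff_nth)
  then have "\<bar>int (p ! m ! i) - int (p ! Suc m ! i)\<bar> \<le> 1"
    using assms(2) by (simp add: parcs_grid)
  then show ?case using step by simp
qed simp

lemma grid_vwalk_length:
  assumes "vwalk p (grid ns)" "i < length ns"
  shows "\<bar>int (last p ! i) - int (hd p ! i)\<bar> \<le> int (vwalk_length p)"
proof -
  have "p \<noteq> []" using assms(1) by (simp add: vwalk_iff_nth)
  then show ?thesis
    using grid_vwalk_nth_diff[OF assms, of 0 "length p - 1"]
    by (simp add: hd_conv_nth last_conv_nth of_nat_diff)
qed

section \<open>Geodesics through the interior\<close>

text \<open>Unit-speed motion from \<open>a\<close> to \<open>b\<close> that waits on arrival.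
  Truncation in \<open>a - t\<close> does no harm: the maximum with \<open>b\<close> absorbs
  it.\<close>

definition toward :: "nat \<Rightarrow> nat \<Rightarrow> nat \<Rightarrow> nat" where
  "toward a b t = (if a \<le> b then min (a + t) b else max (a - t) b)"

text \<open>One coordinate of the geodesic, clamped to \<open>1..n - 2\<close>. Times 0 and
  \<open>d\<close> are exempt, since the end points may lie on the boundary.\<close>

definition inward :: "nat \<Rightarrow> nat \<Rightarrow> nat \<Rightarrow> nat \<Rightarrow> nat \<Rightarrow> nat" where
  "inward n d a b t = (if t = 0 then a else if d \<le> t then b else max 1 (min (n - 2) (toward a b t)))"

text \<open>Clamping moves only 0 and \<open>n - 1\<close>, each onto its neighbour, so a step of
  size at most one stays so whether one end or both are clamped.\<close>

lemma inward_step: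
  assumes "3 \<le> n" "a < n" "b < n" "\<bar>int a - int b\<bar> \<le> int d" "t < d"
  shows "\<bar>int (inward n d a b t) - int (inward n d a b (Suc t))\<bar> \<le> 1"
proof -
  define c where "c u = max 1 (min (n - 2) u)" for u
  \<comment> \<open>The two mixed bounds serve the first and the last step, where just one end is
    clamped.\<close>
  have clamp: "\<bar>int u - int (c v)\<bar> \<le> 1 \<and> \<bar>int (c u) - int v\<bar> \<le> 1 \<and> \<bar>int (c u) - int (c v)\<bar> \<le> 1"
    if uv: "u < n" "v < n" "\<bar>int u - int v\<bar> \<le> 1" for u v
  proof -
    have c: "c w = (if w = 0 then 1 else if Suc w = n then n - 2 else w)" if "w < n" for w
      using that assms(1) by (auto simp: c_def)
    show ?thesis
      unfolding c[OF uv(1)] c[OF uv(2)] using uv assms(1) by auto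
  qed
  have less: "toward a b u < n" for u
    using assms(2,3) by (auto simp: toward_def)
  have step: "\<bar>int (toward a b t) - int (toward a b (Suc t))\<bar> \<le> 1"
    by (cases "a \<le> b") (auto simp: toward_def min_def max_def)
  have ends: "toward a b 0 = a" "toward a b d = b"
    using assms(4) by (auto simp: toward_def)
  have inw: "inward n d a b s = (if s = 0 then a else if d \<le> s then b else c (toward a b s))" for s
    by (simp add: inward_def c_def)
  show ?thesis
    using clamp[OF less less step] step ends assms(5)
    by (cases "t = 0"; cases "Suc t = d") (auto simp: inw)
qed

lemma inward_less:
  assumes "3 \<le> n" "a < n" "b < n"
  shows "inward n d a b t < n"
  using assms by (auto simp: inward_def)

lemma inward_inner:
  assumes "3 \<le> n" "0 < t" "t < d"
  shows "0 < inward n d a b t \<and> Suc (inward n d a b t) < n"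
  using assms by (auto simp: inward_def)

text \<open>With distance exactly \<open>d\<close> the motion never waits, and its intermediate
  values lie strictly between \<open>a\<close> and \<open>b\<close>, where the clamp changes
  nothing.\<close>

lemma inj_on_inward:
  assumes "a < n" "b < n" "\<bar>int a - int b\<bar> = int d"
  shows "inj_on (inward n d a b) {..d}"
proof -
  have "int (inward n d a b t) = (if a \<le> b then int a + int t else int a - int t)" if "t \<le> d" for t
    using assms that unfolding inward_def toward_def by (auto simp: min_def max_def)
  then have "s = t" if "inward n d a b s = inward n d a b t" "s \<le> d" "t \<le> d" for s t
    using that by (metis (no_types, opaque_lifting) add_left_cancel diff_left_imp_eq nat_int)
  then show ?thesis by (auto intro: inj_onI)
qed

text \<open>All coordinates run independently on one clock of length \<open>d\<close>. The
  coordinate \<open>i0\<close>, which needs all of this time, makes the vertices distinct; the clamp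
  keeps the inner ones in \<open>core ns\<close>.\<close>

lemma grid_inner_vpath:
  assumes ns: "\<forall>n\<in>set ns. 3 \<le> n" and "x \<in> box ns" "y \<in> box ns"
    and le: "\<And>i. i < length ns \<Longrightarrow> \<bar>int (x ! i) - int (y ! i)\<bar> \<le> int d"
    and i0: "i0 < length ns" "\<bar>int (x ! i0) - int (y ! i0)\<bar> = int d"
    and "0 < d"
  obtains p where "vpath p (grid ns)" "hd p = x" "last p = y" "vwalk_length p = d"
    "set p - {x, y} \<subseteq> core ns"
proof -
  define w where "w t = map (\<lambda>i. inward (ns ! i) d (x ! i) (y ! i) t) [0..<length ns]" for t
  define p where "p = map w [0..<Suc d]"
  have x: "length x = length ns" "\<And>i. i < length ns \<Longrightarrow> x ! i < ns ! i"
    and y: "length y = length ns" "\<And>i. i < length ns \<Longrightarrow> y ! i < ns ! i"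
    using assms(2,3) by (auto simp: mem_box)
  have n3: "3 \<le> ns ! i" if "i < length ns" for i
    using ns that by simp
  have len_w: "length (w t) = length ns" for t
    by (simp add: w_def)
  have nth_w: "w t ! i = inward (ns ! i) d (x ! i) (y ! i) t" if "i < length ns" for t i
    using that by (simp add: w_def)
  have w0: "w 0 = x"
    by (rule nth_equalityI) (auto simp: len_w x(1) nth_w inward_def)
  have wd: "w d = y"
    by (rule nth_equalityI) (use \<open>0 < d\<close> in \<open>auto simp: len_w y(1) nth_w inward_def\<close>)
  have w_box: "w t \<in> box ns" for t
    using n3 x y by (auto simp: mem_box len_w nth_w intro!: inward_less)
  have w_core: "w t \<in> core ns" if "0 < t" "t < d" for t
    using inward_inner[OF n3 that] by (auto simp: mem_core len_w nth_w)
  have inj: "inj_on w {..d}"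
  proof (rule inj_onI)
    fix s t assume st: "s \<in> {..d}" "t \<in> {..d}" "w s = w t"
    then have "inward (ns ! i0) d (x ! i0) (y ! i0) s = inward (ns ! i0) d (x ! i0) (y ! i0) t"
      using nth_w i0(1) by metis
    then show "s = t"
      using inj_on_inward[OF x(2) y(2) i0(2)] i0(1) st by (auto dest: inj_onD)
  qed
  have nth_p: "p ! t = w t" if "t \<le> d" for t
    using that by (simp add: p_def del: upt_Suc)
  have len_p: "length p = Suc d"
    by (simp add: p_def)
  have "(w t, w (Suc t)) \<in> parcs (grid ns)" if "t < d" for t
    using that n3 x y le inj w_box
    by (auto simp: parcs_grid nth_w inward_step dest: inj_onD)
  then have "vwalk p (grid ns)"
    using w_box len_p by (auto simp: vwalk_iff_nth nth_p pverts_grid p_def simp del: upt_Suc)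
  moreover have "distinct p"
    unfolding p_def distinct_map using inj by (auto simp: inj_on_def simp del: upt_Suc)
  moreover have "p \<noteq> []" using len_p by auto
  moreover have "z \<in> core ns" if "z \<in> set p - {x, y}" for z
  proof -
    from that have "z \<in> w ` {..d}" by (auto simp: p_def)
    then obtain t where "t \<le> d" "z = w t" by auto
    then show ?thesis using that w0 wd w_core[of t] by (cases "t = 0 \<or> t = d") auto
  qed
  ultimately show thesis
    using that[of p] len_p nth_p[of 0] nth_p[of d] w0 wd
    by (auto simp: vpath_def hd_conv_nth last_conv_nth)
qed

text \<open>The inner path has as length the Chebyshev distance \<open>d\<close>, and no walk is
  shorter, because the coordinate attaining the maximum changes by at most one per step.\<close>

lemma grid_visible:
  assumes "\<forall>n\<in>set ns. 3 \<le> n" "x \<in> box ns" "y \<in> box ns" "X \<inter> core ns = {}"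
  shows "visible (grid ns) X x y"
proof (cases "x = y")
  case True
  have "vpath [x] (grid ns)"
    using assms(2) by (auto simp: vpath_def vwalk_iff_nth pverts_grid)
  then show ?thesis
    using True by (auto simp: visible_def shortest_path_def intro!: exI[of _ "[x]"])
next
  case False
  define D where "D = (\<lambda>i. nat \<bar>int (x ! i) - int (y ! i)\<bar>) ` {..<length ns}"
  define d where "d = Max D"
  have len: "length x = length ns" "length y = length ns"
    using assms(2,3) by (auto simp: mem_box)
  then obtain j where j: "j < length ns" "x ! j \<noteq> y ! j"
    using False by (metis nth_equalityI)
  have D: "finite D" "D \<noteq> {}" using j by (auto simp: D_def)
  have le: "\<bar>int (x ! i) - int (y ! i)\<bar> \<le> int d" if "i < length ns" for i
  proof -
    have "nat \<bar>int (x ! i) - int (y ! i)\<bar> \<le> d"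
      unfolding d_def by (rule Max_ge[OF D(1)]) (use that in \<open>auto simp: D_def\<close>)
    then show ?thesis by simp
  qed
  have "d \<in> D" unfolding d_def using D by (rule Max_in)
  then obtain i where i: "i < length ns" "\<bar>int (x ! i) - int (y ! i)\<bar> = int d"
    by (auto simp: D_def)
  have "0 < d" using le[OF j(1)] j(2) by auto
  then obtain p where p: "vpath p (grid ns)" "hd p = x" "last p = y" "vwalk_length p = d"
    "set p - {x, y} \<subseteq> core ns"
    using grid_inner_vpath[OF assms(1-3) le i] by blast
  have "d \<le> vwalk_length q" if "vpath q (grid ns)" "hd q = x" "last q = y" for q
    using grid_vwalk_length[of q ns i] that i by (auto simp: vpath_def)
  then have "shortest_path (grid ns) x p y"
    using p by (simp add: shortest_path_def)
  then show ?thesis using p(5) assms(4) by (auto simp: visible_def)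
qed

section \<open>Diagonals and their unique geodesics\<close>

definition shift :: "nat \<Rightarrow> nat list \<Rightarrow> nat list" where
  "shift m = map ((+) m)"

lemma shift_shift: "shift m (shift l x) = shift (m + l) x"
  by (simp add: shift_def add.assoc)

lemma shift_eq_iff [simp]: "shift m x = shift m y \<longleftrightarrow> x = y"
  by (auto simp: shift_def inj_map_eq_map inj_on_def)

lemma length_shift [simp]: "length (shift m x) = length x"
  by (simp add: shift_def)

lemma nth_shift [simp]: "i < length x \<Longrightarrow> shift m x ! i = m + x ! i"
  by (simp add: shift_def)

lemma shift_0 [simp]: "shift 0 x = x"
  by (simp add: shift_def map_idI)

text \<open>Between two points of a diagonal every coordinate differs by the full distance, so each
  step of a shortest path raises every coordinate by one. The path therefore passes through the
  middle point, which blocks visibility.\<close>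

lemma grid_no_three_on_diagonal:
  assumes ns: "\<forall>n\<in>set ns. 3 \<le> n" "ns \<noteq> []"
    and X: "mutual_visibility_set (grid ns) X"
    and mem: "x \<in> X" "shift a x \<in> X" "shift (a + b) x \<in> X"
  shows "a = 0 \<or> b = 0"
proof (rule ccontr)
  assume ab: "\<not> (a = 0 \<or> b = 0)"
  define y where "y = shift (a + b) x"
  have box: "x \<in> box ns" "y \<in> box ns"
    using X mem by (auto simp: mutual_visibility_set_def pverts_grid y_def)
  then have len: "length x = length ns" by (simp add: mem_box)
  have diff: "\<bar>int (x ! i) - int (y ! i)\<bar> = int (a + b)" if "i < length ns" for i
    using that len by (simp add: y_def)
  from X mem obtain p where p: "shortest_path (grid ns) x p y" "(set p - {x, y}) \<inter> X = {}"
    unfolding mutual_visibility_set_def visible_def y_def by blast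
  then have w: "vwalk p (grid ns)" "p \<noteq> []" "hd p = x" "last p = y"
    by (auto simp: shortest_path_def vpath_def vwalk_iff_nth)
  \<comment> \<open>Only the length of \<open>q\<close> matters: it bounds the shortest path
    \<open>p\<close> from above.\<close>
  obtain q where "vpath q (grid ns)" "hd q = x" "last q = y" "vwalk_length q = a + b"
    using grid_inner_vpath[OF ns(1) box, of "a + b" 0] diff ab ns(2)
    by (metis add_is_0 length_greater_0_conv not_gr0 order_refl)
  then have "length p \<le> Suc (a + b)"
    using p(1) by (force simp: shortest_path_def)
  moreover have "a + b < length p"
    using grid_vwalk_length[OF w(1), of 0] diff[of 0] ns(2) w by (cases p) auto
  ultimately have lp: "length p = Suc (a + b)" by simp
  have "p ! a = shift a x"
  proof (rule nth_equalityI)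
    have "p ! a \<in> box ns" using w(1) lp by (auto simp: vwalk_iff_nth pverts_grid)
    then show "length (p ! a) = length (shift a x)" by (simp add: len mem_box)
    fix i assume "i < length (p ! a)"
    then have i: "i < length ns" using \<open>p ! a \<in> box ns\<close> by (simp add: mem_box)
    have "p ! 0 = x" "p ! (a + b) = y"
      using w lp by (auto simp: hd_conv_nth last_conv_nth)
    \<comment> \<open>A squeeze: coordinate \<open>i\<close> grows by at most \<open>a\<close> in
      the first \<open>a\<close> steps and by at most \<open>b\<close> in the other
      \<open>b\<close>, but by \<open>a + b\<close> in total.\<close>
    then show "p ! a ! i = shift a x ! i"
      using grid_vwalk_nth_diff[OF w(1) i, of 0 a] grid_vwalk_nth_diff[OF w(1) i, of a "a + b"] lp i len
      by (auto simp: y_def)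
  qed
  then have "shift a x \<in> set p" using lp by (metis nth_mem less_Suc_eq_le le_add1)
  moreover have "x ! 0 \<noteq> shift a x ! 0" "shift a x ! 0 \<noteq> y ! 0"
    using ab ns(2) len by (auto simp: y_def)
  ultimately show False using p(2) mem(2) by auto
qed

text \<open>Points with a common translate share a diagonal. As \<open>shift\<close> only moves
  upwards, the two cases record which point is the lower one.\<close>

lemma shift_cases:
  assumes "shift m x = shift l y"
  obtains c where "x = shift c y" | c where "y = shift c x"
proof (cases "m \<le> l")
  case True
  then have "shift m x = shift m (shift (l - m) y)" using assms by (simp add: shift_shift)
  then show ?thesis using that(1) by simp
next
  case False
  then have "shift l y = shift l (shift (m - l) x)" using assms by (simp add: shift_shift)
  then show ?thesis using that(2) by simp
qed

section \<open>Counting by the end points of diagonals\<close>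

text \<open>Slide down by the least coordinate. The zero coordinate of \<open>b\<close> is recorded
  because it later tells bottoms from tops.\<close>

lemma diagonal_bottom:
  assumes "x \<in> box ns" "ns \<noteq> []"
  shows "\<exists>b \<in> box ns - core ns. 0 \<in> set b \<and> (\<exists>m. x = shift m b)"
proof -
  define m where "m = Min (set x)"
  define b where "b = map (\<lambda>a. a - m) x"
  have len: "length x = length ns" "x \<noteq> []" using assms by (auto simp: mem_box)
  have "m \<le> a" if "a \<in> set x" for a using that by (simp add: m_def)
  then have "x = shift m b" by (simp add: b_def shift_def map_idI)
  moreover have "m \<in> set x" using len by (simp add: m_def)
  then have "0 \<in> set b" by (force simp: b_def)
  moreover have "b \<in> box ns" using assms by (auto simp: mem_box b_def less_imp_diff_less)
  moreover have "b \<notin> core ns" using \<open>0 \<in> set b\<close> by (auto simp: mem_core in_set_conv_nth)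
  ultimately show ?thesis by blast
qed

text \<open>Slide up as far as the box allows. The last translate is not in \<open>core ns\<close>,
  since a core point can be raised once more.\<close>

lemma diagonal_top:
  assumes "x \<in> box ns" "ns \<noteq> []"
  shows "\<exists>b \<in> box ns - core ns. \<exists>m. b = shift m x"
proof -
  have bound: "m < ns ! 0" if "shift m x \<in> box ns" for m
    using that assms by (auto simp: mem_box)
  define m where "m = (GREATEST m. shift m x \<in> box ns)"
  have "shift m x \<in> box ns"
    \<comment> \<open>The shift 0 qualifies because \<open>x\<close> is in the box; coordinate 0
      bounds all shifts.\<close>
    unfolding m_def by (rule GreatestI_nat[of _ 0 "ns ! 0"]) (use assms bound in \<open>auto intro: less_imp_le\<close>)
  moreover have "shift m x \<notin> core ns"
  proof
    assume "shift m x \<in> core ns"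
    then have "shift (Suc m) x \<in> box ns" by (auto simp: mem_core mem_box)
    then have "Suc m \<le> m"
      unfolding m_def by (rule Greatest_le_nat[of _ _ "ns ! 0"]) (use bound in \<open>auto intro: less_imp_le\<close>)
    then show False by simp
  qed
  ultimately show ?thesis by blast
qed

text \<open>A diagonal holds at most two points of \<open>X\<close>. Sending an upper one to the top
  end and a lower or only one to the bottom end injects \<open>X\<close> into the boundary.\<close>

lemma card_no_three_on_diagonal:
  assumes "X \<subseteq> box ns" "ns \<noteq> []"
    and no3: "\<And>x a b. x \<in> X \<Longrightarrow> shift a x \<in> X \<Longrightarrow> shift (a + b) x \<in> X \<Longrightarrow> a = 0 \<or> b = 0"
  shows "card X \<le> card (box ns - core ns)"
proof -
  obtain bot where bot: "\<And>x. x \<in> X \<Longrightarrow> bot x \<in> box ns - core ns \<and> 0 \<in> set (bot x) \<and> (\<exists>m. x = shift m (bot x))"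
    using diagonal_bottom[OF _ assms(2)] assms(1) by (metis subsetD)
  obtain top where top: "\<And>x. x \<in> X \<Longrightarrow> top x \<in> box ns - core ns \<and> (\<exists>m. top x = shift m x)"
    using diagonal_top[OF _ assms(2)] assms(1) by (metis subsetD)
  define above where "above x \<longleftrightarrow> (\<exists>y\<in>X. \<exists>a>0. x = shift a y)" for x
  define f where "f x = (if above x then top x else bot x)" for x
  have no_above: "c = 0" if "x \<in> X" "shift c x \<in> X" "above x" for x c
    using no3[of _ _ c] that by (force simp: above_def shift_shift add.commute)
  \<comment> \<open>Two distinct points of \<open>X\<close> on one diagonal differ in
    \<open>above\<close>: the higher satisfies it, and the lower cannot, as that would give three
    points.\<close>
  have eq: "x = y" if xy: "x \<in> X" "y \<in> X" "above x = above y" "shift m x = shift l y" for x y m l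
  proof (cases "above x")
    case True
    from shift_cases[OF xy(4)] show ?thesis
      using True xy no_above by (metis shift_0)
  next
    case False
    from shift_cases[OF xy(4)] show ?thesis
      using False xy unfolding above_def by (metis gr0I shift_0)
  qed
  \<comment> \<open>If \<open>above x\<close>, then \<open>x\<close> is a positive shift, so all
    coordinates of \<open>top x\<close> are positive, whereas \<open>bot y\<close> has a
    zero.\<close>
  have cross: "top x \<noteq> bot y" if xy: "x \<in> X" "y \<in> X" "above x" for x y
  proof
    assume "top x = bot y"
    then have "0 \<in> set (top x)" using bot xy by simp
    then show False using top[OF xy(1)] xy(3) by (auto simp: above_def shift_def)
  qed
  have "inj_on f X"
  proof (rule inj_onI)
    fix x y assume xy: "x \<in> X" "y \<in> X" "f x = f y"
    then have "above x = above y" using cross by (metis f_def)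
    moreover have "\<exists>m l. shift m x = shift l y" if "above x" "above y"
      using xy that top by (metis f_def)
    moreover have "x = y" if "\<not> above x" "\<not> above y"
    proof -
      have "bot x = bot y" using xy(3) that by (simp add: f_def)
      then obtain m l where "x = shift m (bot x)" "y = shift l (bot x)"
        using bot[OF xy(1)] bot[OF xy(2)] by metis
      \<comment> \<open>Both sides equal \<open>shift (m + l) (bot x)\<close>.\<close>
      then have "shift l x = shift m y" by (metis shift_shift add.commute)
      then show ?thesis using eq[OF xy(1,2)] that by simp
    qed
    ultimately show "x = y" using eq[OF xy(1,2)] by metis
  qed
  moreover have "f ` X \<subseteq> box ns - core ns" using bot top by (auto simp: f_def)
  ultimately show ?thesis using finite_box by (metis card_inj_on_le finite_Diff)
qed

section \<open>The mutual-visibility number and the product formula\<close>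

lemma mutual_visibility_number_grid:
  assumes "\<forall>n\<in>set ns. 3 \<le> n" "ns \<noteq> []"
  shows "mutual_visibility_number (grid ns) = card (box ns - core ns)"
  unfolding mutual_visibility_number_def
proof (rule Max_eqI)
  have "{X. mutual_visibility_set (grid ns) X} \<subseteq> Pow (box ns)"
    by (auto simp: mutual_visibility_set_def pverts_grid)
  then have "finite {X. mutual_visibility_set (grid ns) X}"
    using finite_box by (meson finite_Pow_iff finite_subset)
  then show "finite {card X | X. mutual_visibility_set (grid ns) X}" by simp
  show "m \<le> card (box ns - core ns)" if "m \<in> {card X | X. mutual_visibility_set (grid ns) X}" for m
    using that card_no_three_on_diagonal[OF _ assms(2)] grid_no_three_on_diagonal[OF assms]
    by (force simp: mutual_visibility_set_def pverts_grid)
  have "mutual_visibility_set (grid ns) (box ns - core ns)"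
    unfolding mutual_visibility_set_def pverts_grid
    by (intro conjI ballI grid_visible[OF assms(1)]) auto
  then show "card (box ns - core ns) \<in> {card X | X. mutual_visibility_set (grid ns) X}" by blast
qed

theorem theorem4p4:
  fixes k :: nat and n :: "nat \<Rightarrow> nat"
  assumes "k \<ge> 2"
    and "\<And>i. i \<in> {1..k} \<Longrightarrow> n i \<ge> 3"
  shows "int (mutual_visibility_number
            (strong_products (map (\<lambda>i. path_graph (n i)) [1..<Suc k])))
         = (\<Prod>i=1..k. int (n i)) - (\<Prod>i=1..k. (int (n i) - 2))"
proof -
  define ns where "ns = map n [1..<Suc k]"
  have ns: "\<forall>m\<in>set ns. 3 \<le> m" "ns \<noteq> []"
    using assms by (auto simp: ns_def simp del: upt_Suc)
  have prod: "prod_list (map g [1..<Suc k]) = (\<Prod>i=1..k. g i)" for g :: "nat \<Rightarrow> nat"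
    by (simp add: prod.distinct_set_conv_list[symmetric] atLeastLessThanSuc_atLeastAtMost del: upt_Suc)
  have "mutual_visibility_number (grid ns) = card (box ns) - card (core ns)"
    using mutual_visibility_number_grid[OF ns] core_subset_box[of ns] finite_box[of ns]
    by (metis card_Diff_subset finite_subset)
  moreover have "card (core ns) \<le> card (box ns)"
    using core_subset_box finite_box by (rule card_mono[rotated])
  moreover have "card (box ns) = (\<Prod>i=1..k. n i)"
    by (simp only: card_box ns_def prod)
  moreover have "card (core ns) = (\<Prod>i=1..k. n i - 2)"
    by (simp only: card_core ns_def map_map comp_def prod)
  \<comment> \<open>Since \<open>n i\<close> is at least 3, the truncated difference agrees with the
    integer one.\<close>
  moreover have "int (\<Prod>i=1..k. n i - 2) = (\<Prod>i=1..k. int (n i) - 2)"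
    unfolding of_nat_prod by (rule prod.cong) (use assms(2) in \<open>force simp: of_nat_diff\<close>)+
  ultimately show ?thesis
    by (simp add: ns_def comp_def of_nat_diff del: upt_Suc)
qed

end
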